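(* Let $\mathcal{H}$ be a separable Hilbert space and let $W=\{(W_i,\omega_i)\}_{i\in I}$ be a Riesz fusion basis of $\mathcal{H}$, regarded as a $1$-uniform fusion frame (i.e. $\omega_i=1$ for all $i\in I$). A Bessel fusion sequence $V=\{(V_i,\omega_i)\}_{i\in I}$ is an alternate dual fusion frame of $W$ if and only if $$V_i\supseteq S_W^{-1}W_i\qquad\text{for all } i\in I.$$
   Context: $I$ is a countable index set and $\pi_U$ is the orthogonal projection of $\mathcal{H}$ onto a closed subspace $U$. For closed subspaces $W_i\subseteq\mathcal{H}$ and weights $\omega_i>0$, $\{(W_i,\omega_i)\}_{i\in I}$ is a fusion frame if there are $0<A\le B<\infty$ with $A\|f\|^2\le\sum_{i\in I}\omega_i^2\|\pi_{W_i}f\|^2\le B\|f\|^2$ for all $f\in\mathcal{H}$; it is a Bessel fusion sequence if only the upper inequality is required. The fusion frame operator $S_Wf=\sum_{i\in I}\omega_i^2\pi_{W_i}f$ of a fusion frame is bounded, positive and invertible. A family of closed subspaces $\{W_i\}_{i\in I}$ is a Riesz fusion basis if it is complete (its closed linear span is $\mathcal{H}$) and there are constants $A,B>0$ such that $A\sum_{i\in J}\|f_i\|^2\le\|\sum_{i\in J}f_i\|^2\le B\sum_{i\in J}\|f_i\|^2$ for every finite $J\subset I$ and all $f_i\in W_i$. Every Riesz fusion basis is a $1$-uniform fusion frame (all weights equal to $1$). A Bessel fusion sequence $V=\{(V_i,\upsilon_i)\}_{i\in I}$ is an alternate dual (fusion frame) of a fusion frame $W=\{(W_i,\omega_i)\}_{i\in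 I}$ if $f=\sum_{i\in I}\omega_i\upsilon_i\pi_{V_i}S_W^{-1}\pi_{W_i}f$ for all $f\in\mathcal{H}$. *)

theory Defs
  imports "HOL-Analysis.Analysis"
begin

(* Hilbert spaces over the reals and over the complex numbers are treated together.  The
   classes real_inner and complete_space give the real Hilbert space; scal is the
   multiplication by scalars of a field 'k (real or complex), extending scaleR.  For
   'k = real, scal is scaleR.  For 'k = complex, the norm condition makes multiplication by
   the imaginary unit an isometry, so that
       <x, y> = Complex (inner x y) (inner x (scal i y))
   is a complex inner product inducing the same norm, and every complex inner product arises
   in this way from its real part.  A vector is orthogonal to a subspace over 'k with
   respect to <., .> if and only if it is so with respect to inner. *)
locale hilbert_scaling = vector_space scal
  for scal :: "'k::real_normed_field \<Rightarrow> 'a::{real_inner,complete_space} \<Rightarrow> 'a" +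
  assumes scale_of_real: "scal (of_real r) x = r *\<^sub>R x"
    and norm_scale: "norm (scal c x) = norm c * norm x"

lemma hilbert_scaling_real:
  "hilbert_scaling (scaleR :: real \<Rightarrow> 'a::{real_inner,complete_space} \<Rightarrow> 'a)"
  by unfold_locales (simp_all add: algebra_simps)

lemma hilbert_scaling_complex: "hilbert_scaling ((*) :: complex \<Rightarrow> complex \<Rightarrow> complex)"
  by unfold_locales (simp_all add: algebra_simps norm_mult scaleR_conv_of_real)

definition closed_subspace ::
  "('k::real_normed_field \<Rightarrow> 'a::{real_inner,complete_space} \<Rightarrow> 'a) \<Rightarrow> 'a set \<Rightarrow> bool" where
  "closed_subspace scal U \<longleftrightarrow> module.subspace scal U \<and> closed U"

definition orth_proj :: "'a::{real_inner,complete_space} set \<Rightarrow> 'a \<Rightarrow> 'a" where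
  "orth_proj U f = (THE p. p \<in> U \<and> (\<forall>u\<in>U. orthogonal (f - p) u))"

(* Summability is required separately because infsum is 0 for families that are not summable. *)
definition bessel_fusion_sequence ::
  "('k::real_normed_field \<Rightarrow> 'a::{real_inner,complete_space} \<Rightarrow> 'a) \<Rightarrow>
    'i set \<Rightarrow> ('i \<Rightarrow> 'a set) \<Rightarrow> ('i \<Rightarrow> real) \<Rightarrow> bool" where
  "bessel_fusion_sequence scal I W w \<longleftrightarrow>
     (\<forall>i\<in>I. closed_subspace scal (W i) \<and> w i > 0) \<and>
     (\<exists>B>0. \<forall>f.
        (\<lambda>i. (w i)\<^sup>2 * (norm (orth_proj (W i) f))\<^sup>2) summable_on I \<and>
        (\<Sum>\<^sub>\<infinity>i\<in>I. (w i)\<^sup>2 * (norm (orth_proj (W i) f))\<^sup>2) \<le> B * (norm f)\<^sup>2)"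

definition fusion_frame ::
  "('k::real_normed_field \<Rightarrow> 'a::{real_inner,complete_space} \<Rightarrow> 'a) \<Rightarrow>
    'i set \<Rightarrow> ('i \<Rightarrow> 'a set) \<Rightarrow> ('i \<Rightarrow> real) \<Rightarrow> bool" where
  "fusion_frame scal I W w \<longleftrightarrow>
     (\<forall>i\<in>I. closed_subspace scal (W i) \<and> w i > 0) \<and>
     (\<exists>A B. 0 < A \<and> A \<le> B \<and> (\<forall>f.
        (\<lambda>i. (w i)\<^sup>2 * (norm (orth_proj (W i) f))\<^sup>2) summable_on I \<and>
        A * (norm f)\<^sup>2 \<le> (\<Sum>\<^sub>\<infinity>i\<in>I. (w i)\<^sup>2 * (norm (orth_proj (W i) f))\<^sup>2) \<and>
        (\<Sum>\<^sub>\<infinity>i\<in>I. (w i)\<^sup>2 * (norm (orth_proj (W i) f))\<^sup>2) \<le> B * (norm f)\<^sup>2))"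

definition fusion_frame_operator ::
  "'i set \<Rightarrow> ('i \<Rightarrow> 'a::{real_inner,complete_space} set) \<Rightarrow> ('i \<Rightarrow> real) \<Rightarrow> 'a \<Rightarrow> 'a" where
  "fusion_frame_operator I W w f = (\<Sum>\<^sub>\<infinity>i\<in>I. (w i)\<^sup>2 *\<^sub>R orth_proj (W i) f)"

definition riesz_fusion_basis ::
  "('k::real_normed_field \<Rightarrow> 'a::{real_inner,complete_space} \<Rightarrow> 'a) \<Rightarrow>
    'i set \<Rightarrow> ('i \<Rightarrow> 'a set) \<Rightarrow> bool" where
  "riesz_fusion_basis scal I W \<longleftrightarrow>
     (\<forall>i\<in>I. closed_subspace scal (W i)) \<and>
     closure (module.span scal (\<Union>i\<in>I. W i)) = UNIV \<and>
     (\<exists>A B. 0 < A \<and> 0 < B \<and> (\<forall>J f. finite J \<and> J \<subseteq> I \<and> (\<forall>i\<in>J. f i \<in> W i) \<longrightarrow>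
        A * (\<Sum>i\<in>J. (norm (f i))\<^sup>2) \<le> (norm (\<Sum>i\<in>J. f i))\<^sup>2 \<and>
        (norm (\<Sum>i\<in>J. f i))\<^sup>2 \<le> B * (\<Sum>i\<in>J. (norm (f i))\<^sup>2)))"

(* The Bessel sequence (V, v) is the dual, the fusion frame (W, w) the one dualized.
   The inverse of the fusion frame operator is its inverse function, the operator being
   bijective for a fusion frame. *)
definition alternate_dual ::
  "('k::real_normed_field \<Rightarrow> 'a::{real_inner,complete_space} \<Rightarrow> 'a) \<Rightarrow>
    'i set \<Rightarrow> ('i \<Rightarrow> 'a set) \<Rightarrow> ('i \<Rightarrow> real) \<Rightarrow> ('i \<Rightarrow> 'a set) \<Rightarrow> ('i \<Rightarrow> real) \<Rightarrow> bool" where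
  "alternate_dual scal I V v W w \<longleftrightarrow>
     fusion_frame scal I W w \<and> bessel_fusion_sequence scal I V v \<and>
     (\<forall>f. ((\<lambda>i. (w i * v i) *\<^sub>R
              orth_proj (V i) (inv (fusion_frame_operator I W w) (orth_proj (W i) f)))
            has_sum f) I)"

end

theory Submission
  imports Defs
begin

text \<open>Write \<open>P i\<close> for the projection onto \<open>W i\<close> and \<open>S f = (\<Sum>i. P i f)\<close> for the frame operator. The
  point is that for a Riesz basis the family \<open>S\<inverse> (W i)\<close> is biorthogonal to the family \<open>W i\<close>: if
  \<open>g \<in> W i\<close>, then \<open>P i (S\<inverse> g) = g\<close> and \<open>P j (S\<inverse> g) = 0\<close> for \<open>j \<noteq> i\<close> (lemma \<open>P_inv_S\<close>). Indeed
  \<open>g = S (S\<inverse> g) = (\<Sum>j. P j (S\<inverse> g))\<close> is an expansion of \<open>g\<close> with terms in the \<open>W j\<close>, and so is the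
  one whose only term is \<open>g\<close> itself; the lower Riesz inequality makes expansions unique (lemma
  \<open>expansion_zero\<close>).

  Hence, if \<open>V\<close> reconstructs every vector, then applying the reconstruction formula to
  \<open>h = S\<inverse> g\<close> leaves a single nonzero term, and it says that \<open>h\<close> equals its projection onto
  \<open>V i\<close>, so \<open>h \<in> V i\<close>. Conversely, if \<open>S\<inverse> (W i) \<subseteq> V i\<close> for all \<open>i\<close>, the projections onto the
  \<open>V i\<close> act as the identity in the formula, which becomes \<open>S\<inverse> (S f) = f\<close> by continuity of
  \<open>S\<inverse>\<close>.

  The remaining work shows that a Riesz basis is a fusion frame and that its operator is
  bijective. The upper Riesz inequality gives the Bessel bound and the unconditional convergence
  of \<open>S f\<close>; the lower one together with completeness gives the lower frame bound. The latter makes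
  \<open>S\<close> bounded below, so that its range is closed, and since \<open>\<langle>f, S f\<rangle>\<close> is the frame sum of \<open>f\<close>,
  nothing but \<open>0\<close> is orthogonal to the range. Only the real inner product matters throughout, because
  subspaces over the scalar field are real subspaces with the same orthogonal complements.\<close>

section \<open>Orthogonal projections onto closed subspaces of a Hilbert space\<close>

text \<open>By the parallelogram law a minimizing sequence for the distance from \<open>f\<close> to \<open>U\<close> is Cauchy,
  since the midpoints of its members stay in \<open>U\<close> and cannot be much closer to \<open>f\<close>.\<close>

lemma nearest_point_exists:
  fixes U :: "'a::{real_inner,complete_space} set"
  assumes "subspace U" "closed U"
  shows "\<exists>p\<in>U. \<forall>u\<in>U. (norm (f - p))\<^sup>2 \<le> (norm (f - u))\<^sup>2"
proof -
  define q where "q = (INF u\<in>U. (norm (f - u))\<^sup>2)"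
  have U0: "0 \<in> U" using assms(1) by (rule subspace_0)
  have bdd: "bdd_below ((\<lambda>u. (norm (f - u))\<^sup>2) ` U)"
    by (rule bdd_belowI[of _ 0]) auto
  have q_le: "q \<le> (norm (f - u))\<^sup>2" if "u \<in> U" for u
    unfolding q_def using bdd that by (rule cINF_lower)
  have "\<exists>u\<in>U. (norm (f - u))\<^sup>2 < q + 1 / real (Suc n)" for n
    using cINF_less_iff[OF _ bdd, of "q + 1 / real (Suc n)"] U0 unfolding q_def by fastforce
  then obtain x where xU: "\<And>n. x n \<in> U"
    and x_q: "\<And>n. (norm (f - x n))\<^sup>2 < q + 1 / real (Suc n)"
    by metis
  have dist_x: "(norm (x m - x n))\<^sup>2 \<le> 2 / real (Suc m) + 2 / real (Suc n)" for m n
  proof -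
    have "(1/2) *\<^sub>R (x m + x n) \<in> U"
      using assms(1) xU by (simp add: subspace_add subspace_scale)
    then have "q \<le> (norm (f - (1/2) *\<^sub>R (x m + x n)))\<^sup>2" by (rule q_le)
    moreover have "(norm (x m - x n))\<^sup>2
      = 2 * (norm (f - x m))\<^sup>2 + 2 * (norm (f - x n))\<^sup>2
        - 4 * (norm (f - (1/2) *\<^sub>R (x m + x n)))\<^sup>2"
      by (simp add: power2_norm_eq_inner inner_diff_left inner_diff_right inner_add_left
          inner_add_right inner_commute field_simps)
    ultimately show ?thesis using x_q[of m] x_q[of n] by simp
  qed
  have "Cauchy x"
  proof (rule metric_CauchyI)
    fix e :: real assume e: "e > 0"
    obtain N where N: "4 / e\<^sup>2 < real N" using reals_Archimedean2 by blast
    have "dist (x m) (x n) < e" if "m \<ge> N" "n \<ge> N" for m n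
    proof -
      have bound: "2 / real (Suc k) < e\<^sup>2 / 2" if "k \<ge> N" for k
      proof -
        have "4 / e\<^sup>2 < real (Suc k)" using N that by simp
        then have "4 < real (Suc k) * e\<^sup>2" using e by (simp add: field_simps)
        then show ?thesis by (simp add: field_simps)
      qed
      have "(norm (x m - x n))\<^sup>2 < e\<^sup>2"
        using dist_x[of m n] bound[OF that(1)] bound[OF that(2)] by simp
      then show ?thesis using e by (simp add: dist_norm power2_less_imp_less)
    qed
    then show "\<exists>M. \<forall>m\<ge>M. \<forall>n\<ge>M. dist (x m) (x n) < e" by blast
  qed
  then obtain p where p: "x \<longlonglongrightarrow> p"
    using Cauchy_convergent convergent_def by blast
  have "p \<in> U"
    using assms(2) xU p by (meson closed_sequentially)
  moreover have "(norm (f - p))\<^sup>2 \<le> q"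
  proof (rule LIMSEQ_le)
    show "(\<lambda>n. (norm (f - x n))\<^sup>2) \<longlonglongrightarrow> (norm (f - p))\<^sup>2"
      by (intro tendsto_intros p)
    show "(\<lambda>n. q + 1 / real (Suc n)) \<longlonglongrightarrow> q"
      using tendsto_add[OF tendsto_const LIMSEQ_inverse_real_of_nat, of q]
      by (simp add: inverse_eq_divide)
    show "\<exists>N. \<forall>n\<ge>N. (norm (f - x n))\<^sup>2 \<le> q + 1 / real (Suc n)"
      using x_q less_imp_le by blast
  qed
  ultimately show ?thesis using q_le order_trans by blast
qed

text \<open>If \<open>f - p\<close> had a nonzero component along \<open>u\<close>, moving \<open>p\<close> along \<open>u\<close> by that component
  would bring it closer to \<open>f\<close>.\<close>

lemma nearest_point_orthogonal:
  fixes U :: "'a::real_inner set"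
  assumes "subspace U" "p \<in> U" and nearest: "\<forall>u\<in>U. (norm (f - p))\<^sup>2 \<le> (norm (f - u))\<^sup>2"
    and "u \<in> U"
  shows "orthogonal (f - p) u"
proof (cases "u = 0")
  case False
  define c where "c = inner (f - p) u"
  define t where "t = c / (norm u)\<^sup>2"
  have expand: "(norm (v - t *\<^sub>R u))\<^sup>2 = (norm v)\<^sup>2 - 2 * t * inner v u + t\<^sup>2 * (norm u)\<^sup>2" for v
    unfolding power2_norm_eq_inner
    by (simp add: inner_diff_left inner_diff_right inner_commute power2_eq_square algebra_simps)
  have "p + t *\<^sub>R u \<in> U" using assms by (simp add: subspace_add subspace_scale)
  then have "(norm (f - p))\<^sup>2 \<le> (norm ((f - p) - t *\<^sub>R u))\<^sup>2"
    using nearest by (metis diff_diff_eq)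
  also have "\<dots> = (norm (f - p))\<^sup>2 - 2 * t * c + t\<^sup>2 * (norm u)\<^sup>2"
    unfolding c_def by (rule expand)
  also have "\<dots> = (norm (f - p))\<^sup>2 - c\<^sup>2 / (norm u)\<^sup>2"
    using False unfolding t_def by (simp add: field_simps power2_eq_square)
  finally have "c\<^sup>2 / (norm u)\<^sup>2 \<le> 0" by simp
  then have "c\<^sup>2 \<le> 0" using False by (simp add: divide_le_0_iff)
  then show ?thesis by (simp add: c_def orthogonal_def)
qed (simp add: orthogonal_def)

lemma orth_proj_eqI:
  fixes U :: "'a::{real_inner,complete_space} set"
  assumes "subspace U" "p \<in> U" "\<And>u. u \<in> U \<Longrightarrow> orthogonal (f - p) u"
  shows "orth_proj U f = p"
  unfolding orth_proj_def
proof (rule the_equality)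
  fix p' assume p': "p' \<in> U \<and> (\<forall>u\<in>U. orthogonal (f - p') u)"
  then have "p - p' \<in> U" using assms by (simp add: subspace_diff)
  then have "inner (f - p') (p - p') = 0" "inner (f - p) (p - p') = 0"
    using p' assms(3) by (auto simp: orthogonal_def)
  then have "inner (p - p') (p - p') = 0" by (simp add: inner_diff_left)
  then show "p' = p" by simp
qed (use assms in blast)

lemma
  fixes U :: "'a::{real_inner,complete_space} set"
  assumes "subspace U" "closed U"
  shows orth_proj_mem: "orth_proj U f \<in> U"
    and orth_proj_orthogonal: "u \<in> U \<Longrightarrow> orthogonal (f - orth_proj U f) u"
proof -
  obtain p where p: "p \<in> U" "\<forall>u\<in>U. (norm (f - p))\<^sup>2 \<le> (norm (f - u))\<^sup>2"
    using nearest_point_exists[OF assms] by blast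
  have orth: "orthogonal (f - p) u" if "u \<in> U" for u
    using nearest_point_orthogonal[OF assms(1) p that] .
  have eq: "orth_proj U f = p" using orth_proj_eqI[OF assms(1) p(1) orth] .
  show "orth_proj U f \<in> U" using p eq by simp
  show "u \<in> U \<Longrightarrow> orthogonal (f - orth_proj U f) u" using orth eq by simp
qed

lemma inner_orth_proj:
  fixes U :: "'a::{real_inner,complete_space} set"
  assumes "subspace U" "closed U" "u \<in> U"
  shows "inner (orth_proj U f) u = inner f u"
  using orth_proj_orthogonal[OF assms(1,2), of u f] assms(3)
  by (simp add: orthogonal_def inner_diff_left)

lemma norm_orth_proj_sq:
  fixes U :: "'a::{real_inner,complete_space} set"
  assumes "subspace U" "closed U"
  shows "(norm (orth_proj U f))\<^sup>2 = inner f (orth_proj U f)"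
  using inner_orth_proj[OF assms orth_proj_mem[OF assms]] by (simp add: power2_norm_eq_inner)

lemma orth_proj_id:
  fixes U :: "'a::{real_inner,complete_space} set"
  assumes "subspace U" "u \<in> U"
  shows "orth_proj U u = u"
  by (rule orth_proj_eqI) (use assms in \<open>auto simp: orthogonal_def\<close>)

lemma linear_orth_proj:
  fixes U :: "'a::{real_inner,complete_space} set"
  assumes "subspace U" "closed U"
  shows "linear (orth_proj U)"
proof (rule linearI)
  fix x y :: 'a and r :: real
  note mem = orth_proj_mem[OF assms] and inner_eq = inner_orth_proj[OF assms]
  show "orth_proj U (x + y) = orth_proj U x + orth_proj U y"
  proof (rule orth_proj_eqI[OF assms(1)])
    show "orth_proj U x + orth_proj U y \<in> U" by (intro subspace_add assms(1) mem)
  qed (simp add: orthogonal_def inner_diff_left inner_add_left inner_eq)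
  show "orth_proj U (r *\<^sub>R x) = r *\<^sub>R orth_proj U x"
  proof (rule orth_proj_eqI[OF assms(1)])
    show "r *\<^sub>R orth_proj U x \<in> U" by (intro subspace_scale assms(1) mem)
  qed (simp add: orthogonal_def inner_diff_left inner_eq)
qed

lemma closed_subspace_eq_UNIV:
  fixes U :: "'a::{real_inner,complete_space} set"
  assumes "subspace U" "closed U" and trivial: "\<And>y. (\<And>u. u \<in> U \<Longrightarrow> orthogonal y u) \<Longrightarrow> y = 0"
  shows "U = UNIV"
proof -
  have "f \<in> U" for f
  proof -
    have "f - orth_proj U f = 0"
      using orth_proj_orthogonal[OF assms(1,2)] by (intro trivial)
    then show ?thesis using orth_proj_mem[OF assms(1,2), of f] by simp
  qed
  then show ?thesis by auto
qed

section \<open>Unconditional summability from square summability\<close>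

text \<open>Orthogonal series converge unconditionally when their squared norms are summable; the same
  holds when the squared norms of finite partial sums are merely dominated by the corresponding
  sums of a summable family. The reason is that the bound, applied to finite sets that avoid a large \<open>F0\<close>, makes the
  net of partial sums Cauchy.\<close>

lemma summable_on_of_square_bound:
  fixes x :: "'i \<Rightarrow> 'a::{real_inner,complete_space}" and c :: "'i \<Rightarrow> real"
  assumes c: "c summable_on I" and c_nonneg: "\<And>i. i \<in> I \<Longrightarrow> c i \<ge> 0"
    and bound: "\<And>J. finite J \<Longrightarrow> J \<subseteq> I \<Longrightarrow> (norm (\<Sum>i\<in>J. x i))\<^sup>2 \<le> (\<Sum>i\<in>J. c i)"
  shows "x summable_on I"
proof -
  have "\<exists>P. eventually P (finite_subsets_at_top I) \<and>
          (\<forall>F F'. P F \<and> P F' \<longrightarrow> dist (sum x F) (sum x F') < e)" if e: "e > 0" for e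
  proof -
    obtain F0 where F0: "finite F0" "F0 \<subseteq> I" "dist (sum c F0) (infsum c I) \<le> (e/3)\<^sup>2"
      using infsum_finite_approximation[OF c, of "(e/3)\<^sup>2"] e by auto
    define P where "P F \<longleftrightarrow> finite F \<and> F0 \<subseteq> F \<and> F \<subseteq> I" for F
    have near: "dist (sum x F) (sum x F0) \<le> e/3" if "P F" for F
    proof -
      have F: "finite F" "F0 \<subseteq> F" "F \<subseteq> I" using that by (auto simp: P_def)
      have "(norm (sum x (F - F0)))\<^sup>2 \<le> sum c (F - F0)"
        by (rule bound) (use F in auto)
      also have "\<dots> = sum c F - sum c F0" using F F0 by (simp add: sum_diff)
      also have "\<dots> \<le> infsum c I - sum c F0"
        using finite_sum_le_infsum[OF c F(1,3)] c_nonneg by simp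
      also have "\<dots> \<le> (e/3)\<^sup>2" using F0(3) by (simp add: dist_real_def)
      finally have "norm (sum x (F - F0)) \<le> e/3"
        using e by (simp add: power2_le_iff_abs_le)
      then show ?thesis using F F0 by (simp add: dist_norm sum_diff)
    qed
    have "eventually P (finite_subsets_at_top I)"
      unfolding eventually_finite_subsets_at_top P_def using F0 by blast
    moreover have "dist (sum x F) (sum x F') < e" if "P F" "P F'" for F F'
      using dist_triangle2[of "sum x F" "sum x F'" "sum x F0"] near[OF that(1)] near[OF that(2)] e
      by simp
    ultimately show ?thesis by blast
  qed
  then have "cauchy_filter (filtermap (sum x) (finite_subsets_at_top I))"
    by (simp add: cauchy_filter_metric_filtermap)
  then obtain l where "(sum x \<longlongrightarrow> l) (finite_subsets_at_top I)"
    using complete_uniform[where S = "UNIV :: 'a set"] complete_UNIV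
    by (force simp add: filterlim_def)
  then show ?thesis using summable_on_def has_sum_def by blast
qed

section \<open>Riesz decompositions of a Hilbert space\<close>

text \<open>The analytic content of a Riesz fusion basis with its two constants made explicit, over the real
  scalars: density is required of the finite sums themselves, which form the linear span
  over any scalar field under which the \<open>W i\<close> are subspaces.\<close>

locale riesz_decomposition =
  fixes I :: "'i set" and W :: "'i \<Rightarrow> 'a::{real_inner,complete_space} set" and A B :: real
  assumes subspace_W: "i \<in> I \<Longrightarrow> subspace (W i)"
    and closed_W: "i \<in> I \<Longrightarrow> closed (W i)"
    and A_pos: "0 < A" and B_pos: "0 < B"
    and lower: "\<lbrakk>finite J; J \<subseteq> I; \<And>i. i \<in> J \<Longrightarrow> g i \<in> W i\<rbrakk>
      \<Longrightarrow> A * (\<Sum>i\<in>J. (norm (g i))\<^sup>2) \<le> (norm (\<Sum>i\<in>J. g i))\<^sup>2"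
    and upper: "\<lbrakk>finite J; J \<subseteq> I; \<And>i. i \<in> J \<Longrightarrow> g i \<in> W i\<rbrakk>
      \<Longrightarrow> (norm (\<Sum>i\<in>J. g i))\<^sup>2 \<le> B * (\<Sum>i\<in>J. (norm (g i))\<^sup>2)"
    and dense: "closure {\<Sum>i\<in>J. g i | J g. finite J \<and> J \<subseteq> I \<and> (\<forall>i\<in>J. g i \<in> W i)} = UNIV"
begin

abbreviation P :: "'i \<Rightarrow> 'a \<Rightarrow> 'a" where
  "P i \<equiv> orth_proj (W i)"

abbreviation energy :: "'a \<Rightarrow> real" where
  "energy f \<equiv> (\<Sum>\<^sub>\<infinity>i\<in>I. (norm (P i f))\<^sup>2)"

definition S :: "'a \<Rightarrow> 'a" where
  "S f = (\<Sum>\<^sub>\<infinity>i\<in>I. P i f)"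

lemma P_mem: "i \<in> I \<Longrightarrow> P i f \<in> W i"
  by (simp add: orth_proj_mem subspace_W closed_W)

text \<open>The finite sum \<open>s\<close> equals \<open>\<langle>f, \<Sum>i\<in>J. P i f\<rangle>\<close>. By Cauchy-Schwarz and the upper Riesz
  inequality, \<open>s\<^sup>2 \<le> \<parallel>f\<parallel>\<^sup>2 * B * s\<close>, and one factor \<open>s\<close> cancels.\<close>

lemma finite_energy_le:
  assumes "finite J" "J \<subseteq> I"
  shows "(\<Sum>i\<in>J. (norm (P i f))\<^sup>2) \<le> B * (norm f)\<^sup>2"
proof -
  define s where "s = (\<Sum>i\<in>J. (norm (P i f))\<^sup>2)"
  have s_nonneg: "s \<ge> 0" unfolding s_def by (simp add: sum_nonneg)
  have "s = inner f (\<Sum>i\<in>J. P i f)"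
    unfolding s_def inner_sum_right
    by (rule sum.cong) (use assms in \<open>auto intro!: norm_orth_proj_sq subspace_W closed_W\<close>)
  also have "\<dots> \<le> norm f * norm (\<Sum>i\<in>J. P i f)" by (rule norm_cauchy_schwarz)
  finally have "s\<^sup>2 \<le> (norm f)\<^sup>2 * (norm (\<Sum>i\<in>J. P i f))\<^sup>2"
    using s_nonneg by (metis power_mono power_mult_distrib)
  also have "\<dots> \<le> (norm f)\<^sup>2 * (B * s)"
    unfolding s_def using assms by (intro mult_left_mono upper) (auto intro: P_mem)
  finally have "s * s \<le> (B * (norm f)\<^sup>2) * s" by (simp add: power2_eq_square mult_ac)
  then show ?thesis
    using s_nonneg B_pos unfolding s_def[symmetric]
    by (cases "s = 0") (auto simp: mult_le_cancel_right)
qed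

lemma energy_summable: "(\<lambda>i. (norm (P i f))\<^sup>2) summable_on I"
  by (rule nonneg_bdd_above_summable_on)
    (auto intro!: bdd_aboveI2[where M = "B * (norm f)\<^sup>2"] finite_energy_le)

lemma energy_le: "energy f \<le> B * (norm f)\<^sup>2"
  by (rule infsum_le_finite_sums[OF energy_summable finite_energy_le])

text \<open>For a finite sum \<open>h\<close> of vectors \<open>g i \<in> W i\<close>, \<open>\<langle>f, h\<rangle> = (\<Sum>i. \<langle>P i f, g i\<rangle>)\<close>, so Cauchy-Schwarz
  and the lower Riesz inequality bound \<open>\<langle>f, h\<rangle>\<close> by \<open>sqrt (energy f) * \<parallel>h\<parallel> / sqrt A\<close>. This
  persists for limits of such \<open>h\<close>, hence for \<open>h = f\<close>.\<close>

lemma energy_ge: "A * (norm f)\<^sup>2 \<le> energy f"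
proof -
  define D where "D = {\<Sum>i\<in>J. g i | J g. finite J \<and> J \<subseteq> I \<and> (\<forall>i\<in>J. g i \<in> W i)}"
  define K where "K = {h. sqrt A * inner f h \<le> sqrt (energy f) * norm h}"
  have "D \<subseteq> K"
  proof
    fix h assume "h \<in> D"
    then obtain J g where J: "finite J" "J \<subseteq> I" and g: "\<And>i. i \<in> J \<Longrightarrow> g i \<in> W i"
      and h: "h = (\<Sum>i\<in>J. g i)"
      unfolding D_def by blast
    have "inner f h = (\<Sum>i\<in>J. inner (P i f) (g i))"
      unfolding h inner_sum_right
      by (rule sum.cong) (use J g in \<open>auto simp: inner_orth_proj subspace_W closed_W\<close>)
    also have "\<dots> \<le> (\<Sum>i\<in>J. \<bar>norm (P i f)\<bar> * \<bar>norm (g i)\<bar>)"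
      by (rule sum_mono) (simp add: norm_cauchy_schwarz)
    also have "\<dots> \<le> L2_set (\<lambda>i. norm (P i f)) J * L2_set (\<lambda>i. norm (g i)) J"
      by (rule L2_set_mult_ineq)
    also have "\<dots> \<le> sqrt (energy f) * L2_set (\<lambda>i. norm (g i)) J"
      unfolding L2_set_def
      by (intro mult_right_mono real_sqrt_le_mono finite_sum_le_infsum energy_summable J)
        (auto simp: sum_nonneg)
    finally have "sqrt A * inner f h \<le> sqrt (energy f) * (sqrt A * L2_set (\<lambda>i. norm (g i)) J)"
      using A_pos by (simp add: mult.left_commute)
    also have "sqrt A * L2_set (\<lambda>i. norm (g i)) J = sqrt (A * (\<Sum>i\<in>J. (norm (g i))\<^sup>2))"
      by (simp add: L2_set_def real_sqrt_mult)
    also have "\<dots> \<le> norm h"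
      using real_sqrt_le_mono[OF lower[OF J g]] by (simp add: h)
    finally show "h \<in> K"
      unfolding K_def by (simp add: mult_left_mono infsum_nonneg)
  qed
  moreover have "closed K"
    unfolding K_def by (intro closed_Collect_le continuous_intros)
  ultimately have "closure D \<subseteq> K" by (rule closure_minimal)
  then have "f \<in> K" using dense unfolding D_def by blast
  then have "sqrt A * norm f * norm f \<le> sqrt (energy f) * norm f"
    unfolding K_def by (simp add: power2_norm_eq_inner[symmetric] power2_eq_square mult.assoc)
  then have "sqrt A * norm f \<le> sqrt (energy f)"
    by (cases "f = 0") (auto simp: infsum_nonneg)
  then have "(sqrt A * norm f)\<^sup>2 \<le> (sqrt (energy f))\<^sup>2"
    using A_pos by (intro power_mono) auto
  then show ?thesis
    using A_pos by (simp add: power_mult_distrib infsum_nonneg)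
qed

lemma P_has_sum: "((\<lambda>i. P i f) has_sum S f) I"
proof -
  have "(\<lambda>i. P i f) summable_on I"
  proof (rule summable_on_of_square_bound)
    show "(\<lambda>i. B * (norm (P i f))\<^sup>2) summable_on I"
      by (intro summable_on_cmult_right energy_summable)
    show "(norm (\<Sum>i\<in>J. P i f))\<^sup>2 \<le> (\<Sum>i\<in>J. B * (norm (P i f))\<^sup>2)"
      if "finite J" "J \<subseteq> I" for J
      using upper[of J "\<lambda>i. P i f"] that P_mem by (auto simp: sum_distrib_left)
  qed (use B_pos in simp)
  then show ?thesis unfolding S_def by (rule has_sum_infsum)
qed

lemma inner_S: "inner f (S f) = energy f"
proof -
  have "((\<lambda>i. inner f (P i f)) has_sum inner f (S f)) I"
    by (rule has_sum_bounded_linear[OF bounded_linear_inner_right P_has_sum])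
  also have "?this \<longleftrightarrow> ((\<lambda>i. (norm (P i f))\<^sup>2) has_sum inner f (S f)) I"
    by (rule has_sum_cong) (simp add: norm_orth_proj_sq subspace_W closed_W)
  finally show ?thesis by (simp add: infsumI)
qed

lemma norm_S_ge: "A * norm f \<le> norm (S f)"
proof (cases "f = 0")
  case False
  have "A * norm f * norm f \<le> inner f (S f)"
    using energy_ge[of f] by (simp add: inner_S power2_eq_square mult.assoc)
  also have "\<dots> \<le> norm (S f) * norm f" using norm_cauchy_schwarz[of f "S f"] by (simp add: mult.commute)
  finally show ?thesis using False by simp
qed simp

lemma norm_S_le: "norm (S f) \<le> B * norm f"
proof -
  have "(norm (\<Sum>i\<in>J. P i f)) \<le> B * norm f" if J: "finite J" "J \<subseteq> I" for J
  proof -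
    have "(norm (\<Sum>i\<in>J. P i f))\<^sup>2 \<le> B * (\<Sum>i\<in>J. (norm (P i f))\<^sup>2)"
      using J P_mem by (intro upper) auto
    also have "\<dots> \<le> B * (B * (norm f)\<^sup>2)"
      using B_pos finite_energy_le[OF J] by (intro mult_left_mono) auto
    finally have "(norm (\<Sum>i\<in>J. P i f))\<^sup>2 \<le> (B * norm f)\<^sup>2"
      by (simp add: power2_eq_square mult_ac)
    then show ?thesis using B_pos by (simp add: power2_le_iff_abs_le)
  qed
  then have "eventually (\<lambda>J. norm (\<Sum>i\<in>J. P i f) \<le> B * norm f) (finite_subsets_at_top I)"
    by (intro eventually_finite_subsets_at_top_weakI)
  moreover have "((\<lambda>J. norm (\<Sum>i\<in>J. P i f)) \<longlongrightarrow> norm (S f)) (finite_subsets_at_top I)"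
    using P_has_sum[of f] unfolding has_sum_def by (rule tendsto_norm)
  ultimately show ?thesis
    by (intro tendsto_upperbound) auto
qed

lemma bounded_linear_S: "bounded_linear S"
proof (rule bounded_linear_intro)
  fix x y :: 'a and r :: real
  have "((\<lambda>i. P i x + P i y) has_sum (S x + S y)) I"
    by (intro has_sum_add P_has_sum)
  also have "?this \<longleftrightarrow> ((\<lambda>i. P i (x + y)) has_sum (S x + S y)) I"
    by (rule has_sum_cong) (simp add: linear_orth_proj linear_add subspace_W closed_W)
  finally show "S (x + y) = S x + S y" using P_has_sum has_sum_unique by blast
  have "((\<lambda>i. r *\<^sub>R P i x) has_sum (r *\<^sub>R S x)) I"
    by (intro has_sum_scaleR P_has_sum)
  also have "?this \<longleftrightarrow> ((\<lambda>i. P i (r *\<^sub>R x)) has_sum (r *\<^sub>R S x)) I"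
    by (rule has_sum_cong) (simp add: linear_orth_proj linear_scale subspace_W closed_W)
  finally show "S (r *\<^sub>R x) = r *\<^sub>R S x" using P_has_sum has_sum_unique by blast
  show "norm (S x) \<le> norm x * B" using norm_S_le[of x] by (simp add: mult.commute)
qed

text \<open>The lower bound \<open>norm_S_ge\<close> gives injectivity and, by completeness, a closed range; a vector
  \<open>y\<close> orthogonal to the range has \<open>energy y = \<langle>y, S y\<rangle> = 0\<close> and so vanishes.\<close>

lemma bij_S: "bij S"
proof (rule bijI)
  interpret S: bounded_linear S by (rule bounded_linear_S)
  show "inj S"
  proof (rule injI)
    fix x y assume "S x = S y"
    then have "A * norm (x - y) \<le> 0" using norm_S_ge[of "x - y"] by (simp add: S.diff)
    then show "x = y" using A_pos by (simp add: mult_le_0_iff)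
  qed
  show "range S = UNIV"
  proof (rule closed_subspace_eq_UNIV)
    show "subspace (range S)" by (simp add: S.linear linear_subspace_image)
    have "complete (range S)"
      by (rule complete_isometric_image[OF A_pos subspace_UNIV bounded_linear_S])
        (simp_all add: norm_S_ge complete_UNIV)
    then show "closed (range S)" by (rule complete_imp_closed)
    fix y assume "\<And>u. u \<in> range S \<Longrightarrow> orthogonal y u"
    then have "inner y (S y) = 0" by (simp add: orthogonal_def)
    then have "A * (norm y)\<^sup>2 \<le> 0" using energy_ge[of y] by (simp add: inner_S)
    then show "y = 0" using A_pos by (simp add: mult_le_0_iff)
  qed
qed

lemma S_inv: "S (inv S f) = f"
  by (simp add: bij_S bij_is_surj surj_f_inv_f)

lemma inv_S: "inv S (S f) = f"
  by (simp add: bij_S bij_is_inj)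

lemma bounded_linear_inv_S: "bounded_linear (inv S)"
proof (rule bounded_linear_intro)
  interpret S: bounded_linear S by (rule bounded_linear_S)
  fix x y :: 'a and r :: real
  show "inv S (x + y) = inv S x + inv S y"
    by (metis S.add S_inv inv_S)
  show "inv S (r *\<^sub>R x) = r *\<^sub>R inv S x"
    by (metis S.scaleR S_inv inv_S)
  show "norm (inv S x) \<le> norm x * (1 / A)"
    using norm_S_ge[of "inv S x"] A_pos by (simp add: S_inv field_simps)
qed

text \<open>The lower Riesz inequality bounds a single term by every partial sum that contains it, and the
  partial sums tend to zero.\<close>

lemma expansion_zero:
  assumes x: "\<And>i. i \<in> I \<Longrightarrow> x i \<in> W i" and sum0: "(x has_sum 0) I" and "j \<in> I"
  shows "x j = 0"
proof -
  have "A * (norm (x j))\<^sup>2 \<le> 0"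
  proof (rule tendsto_lowerbound)
    show "((\<lambda>J. (norm (sum x J))\<^sup>2) \<longlongrightarrow> 0) (finite_subsets_at_top I)"
      using tendsto_power[OF tendsto_norm[OF sum0[unfolded has_sum_def]], of 2] by simp
    have "A * (norm (x j))\<^sup>2 \<le> (norm (sum x J))\<^sup>2" if "finite J" "{j} \<subseteq> J" "J \<subseteq> I" for J
    proof -
      have "(norm (x j))\<^sup>2 \<le> (\<Sum>i\<in>J. (norm (x i))\<^sup>2)"
        using that by (intro member_le_sum) auto
      then have "A * (norm (x j))\<^sup>2 \<le> A * (\<Sum>i\<in>J. (norm (x i))\<^sup>2)"
        using A_pos by simp
      also have "\<dots> \<le> (norm (sum x J))\<^sup>2"
        using that x by (intro lower) auto
      finally show ?thesis .
    qed
    then show "eventually (\<lambda>J. A * (norm (x j))\<^sup>2 \<le> (norm (sum x J))\<^sup>2) (finite_subsets_at_top I)"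
      unfolding eventually_finite_subsets_at_top using \<open>j \<in> I\<close>
      by (intro exI[of _ "{j}"]) auto
  qed simp
  then show ?thesis using A_pos by (simp add: mult_le_0_iff)
qed

text \<open>Biorthogonality: the terms of \<open>g = (\<Sum>j. P j (inv S g))\<close> must agree with those of the trivial
  expansion of \<open>g\<close>, because their differences expand zero.\<close>

lemma P_inv_S:
  assumes "i \<in> I" "j \<in> I" "g \<in> W i"
  shows "P j (inv S g) = (if j = i then g else 0)"
proof -
  define x where "x j = P j (inv S g) - (if j = i then g else 0)" for j
  have "x j = 0"
  proof (rule expansion_zero[OF _ _ \<open>j \<in> I\<close>])
    show "x k \<in> W k" if "k \<in> I" for k
      unfolding x_def using that assms P_mem subspace_W
      by (auto intro!: subspace_diff subspace_0)
    have "((\<lambda>j. if j = i then g else 0) has_sum g) I"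
      by (rule has_sum_finite_neutralI[of "{i}"]) (use assms in auto)
    then have "((\<lambda>j. - (if j = i then g else 0)) has_sum - g) I"
      by (simp only: has_sum_uminus minus_minus)
    from has_sum_add[OF P_has_sum[of "inv S g"] this]
    show "(x has_sum 0) I" unfolding x_def by (simp add: S_inv)
  qed
  then show ?thesis by (simp add: x_def)
qed

text \<open>For necessity the formula is applied to \<open>h = inv S g\<close> with \<open>g \<in> W i\<close>, whose expansion has the
  single term \<open>P i h = g\<close>; for sufficiency the projections onto the \<open>V i\<close> disappear.\<close>

lemma reconstruction_iff:
  assumes V: "\<And>i. i \<in> I \<Longrightarrow> subspace (V i) \<and> closed (V i)"
  shows "(\<forall>f. ((\<lambda>i. orth_proj (V i) (inv S (P i f))) has_sum f) I)
    \<longleftrightarrow> (\<forall>i\<in>I. inv S ` W i \<subseteq> V i)"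
proof
  assume dual: "\<forall>f. ((\<lambda>i. orth_proj (V i) (inv S (P i f))) has_sum f) I"
  show "\<forall>i\<in>I. inv S ` W i \<subseteq> V i"
  proof (intro ballI subsetI)
    fix i h assume i: "i \<in> I" and "h \<in> inv S ` W i"
    then obtain g where g: "g \<in> W i" "h = inv S g" by blast
    interpret T: bounded_linear "inv S" by (rule bounded_linear_inv_S)
    have "((\<lambda>j. orth_proj (V j) (inv S (P j h))) has_sum orth_proj (V i) h) I"
    proof (rule has_sum_finite_neutralI[of "{i}"])
      show "orth_proj (V j) (inv S (P j h)) = 0" if "j \<in> I - {i}" for j
        using that i g V by (auto simp: P_inv_S T.zero orth_proj_id subspace_0)
    qed (use i g in \<open>auto simp: P_inv_S\<close>)
    then have "h = orth_proj (V i) h" using dual has_sum_unique by blast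
    then show "h \<in> V i" using orth_proj_mem V[OF i] by metis
  qed
next
  assume sub: "\<forall>i\<in>I. inv S ` W i \<subseteq> V i"
  show "\<forall>f. ((\<lambda>i. orth_proj (V i) (inv S (P i f))) has_sum f) I"
  proof
    fix f
    have "((\<lambda>i. inv S (P i f)) has_sum f) I"
      using has_sum_bounded_linear[OF bounded_linear_inv_S P_has_sum[of f]] by (simp add: inv_S)
    also have "?this \<longleftrightarrow> ((\<lambda>i. orth_proj (V i) (inv S (P i f))) has_sum f) I"
    proof (rule has_sum_cong)
      fix i assume i: "i \<in> I"
      then have "inv S (P i f) \<in> V i" using sub P_mem by blast
      then show "inv S (P i f) = orth_proj (V i) (inv S (P i f))"
        using V[OF i] by (simp add: orth_proj_id)
    qed
    finally show "((\<lambda>i. orth_proj (V i) (inv S (P i f))) has_sum f) I" .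
  qed
qed

end

section \<open>Riesz fusion bases and their alternate duals\<close>

lemma closed_subspace_real:
  assumes "hilbert_scaling scal" "closed_subspace scal U"
  shows "subspace U"
proof -
  interpret hilbert_scaling scal by fact
  show ?thesis
  proof (unfold real_vector.subspace_def, intro conjI ballI allI)
    fix x and r :: real assume "x \<in> U"
    then show "r *\<^sub>R x \<in> U"
      using assms(2) subspace_scale[of U x "of_real r"] by (simp add: closed_subspace_def scale_of_real)
  qed (use assms(2) in \<open>auto simp: closed_subspace_def subspace_0 subspace_add\<close>)
qed

text \<open>Grouping a linear combination by index: the terms in the same \<open>W i\<close> add up to one vector of
  \<open>W i\<close>.\<close>

lemma span_Union_finite_sum:
  assumes "hilbert_scaling scal" and W: "\<And>i. i \<in> I \<Longrightarrow> closed_subspace scal (W i)"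
    and "h \<in> module.span scal (\<Union>i\<in>I. W i)"
  shows "\<exists>J g. h = (\<Sum>i\<in>J. g i) \<and> finite J \<and> J \<subseteq> I \<and> (\<forall>i\<in>J. g i \<in> W i)"
proof -
  interpret hilbert_scaling scal by fact
  have sub: "subspace (W i)" if "i \<in> I" for i
    using W[OF that] by (simp add: closed_subspace_def)
  show ?thesis using assms(3)
  proof (induction rule: span_induct_alt)
    case base
    show ?case by (intro exI[of _ "{}"]) auto
  next
    case (step c x y)
    then obtain i J g where i: "i \<in> I" "x \<in> W i" and J: "finite J" "J \<subseteq> I"
      and g: "\<forall>i\<in>J. g i \<in> W i" and y: "y = (\<Sum>i\<in>J. g i)"
      by blast
    \<comment> \<open>\<open>g\<close> is arbitrary off \<open>J\<close>, so it is cut off before \<open>i\<close> joins the index set.\<close>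
    define g0 where "g0 k = (if k \<in> J then g k else 0)" for k
    define g' where "g' k = (if k = i then scal c x else 0) + g0 k" for k
    have "sum g0 (insert i J) = y"
      unfolding y using J by (intro sum.mono_neutral_cong_right) (auto simp: g0_def)
    then have "scal c x + y = sum g' (insert i J)"
      unfolding g'_def sum.distrib using J by (simp add: sum.delta)
    moreover have "g' k \<in> W k" if "k \<in> insert i J" for k
      unfolding g'_def g0_def using that i J g sub
      by (auto intro!: subspace_add subspace_scale subspace_0)
    ultimately show ?case using i J by (intro exI[of _ "insert i J"] exI[of _ g']) auto
  qed
qed

lemma riesz_fusion_basis_decomposition:
  fixes scal :: "'k::real_normed_field \<Rightarrow> 'a::{real_inner,complete_space} \<Rightarrow> 'a"
    and I :: "'i set" and W :: "'i \<Rightarrow> 'a set"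
  assumes "hilbert_scaling scal" "riesz_fusion_basis scal I W"
  obtains A B where "riesz_decomposition I W A B"
proof -
  have W: "\<And>i. i \<in> I \<Longrightarrow> closed_subspace scal (W i)"
    using assms(2) by (simp add: riesz_fusion_basis_def)
  have dense: "closure (module.span scal (\<Union>i\<in>I. W i)) = UNIV"
    using assms(2) by (simp add: riesz_fusion_basis_def)
  obtain A B where AB: "0 < A" "0 < B"
    and bounds: "\<forall>J f. finite J \<and> J \<subseteq> I \<and> (\<forall>i\<in>J. f i \<in> W i) \<longrightarrow>
        A * (\<Sum>i\<in>J. (norm (f i))\<^sup>2) \<le> (norm (\<Sum>i\<in>J. f i))\<^sup>2 \<and>
        (norm (\<Sum>i\<in>J. f i))\<^sup>2 \<le> B * (\<Sum>i\<in>J. (norm (f i))\<^sup>2)"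
    using assms(2) unfolding riesz_fusion_basis_def by (elim conjE exE)
  have "riesz_decomposition I W A B"
  proof
    have "module.span scal (\<Union>i\<in>I. W i)
        \<subseteq> {\<Sum>i\<in>J. g i | J g. finite J \<and> J \<subseteq> I \<and> (\<forall>i\<in>J. g i \<in> W i)}"
      by (intro subsetI CollectI span_Union_finite_sum[OF assms(1) W])
    from closure_mono[OF this] dense
    show "closure {\<Sum>i\<in>J. g i | J g. finite J \<and> J \<subseteq> I \<and> (\<forall>i\<in>J. g i \<in> W i)} = UNIV"
      by (simp add: top.extremum_unique)
  next
    fix i assume "i \<in> I"
    then show "subspace (W i)" "closed (W i)"
      using W closed_subspace_real[OF assms(1)] by (auto simp: closed_subspace_def)
  next
    show "0 < A" "0 < B" by fact+
  next
    fix J and g :: "'i \<Rightarrow> 'a"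
    assume "finite J" "J \<subseteq> I" "\<And>i. i \<in> J \<Longrightarrow> g i \<in> W i"
    then have "finite J \<and> J \<subseteq> I \<and> (\<forall>i\<in>J. g i \<in> W i)" by blast
    from bounds[rule_format, OF this]
    show "A * (\<Sum>i\<in>J. (norm (g i))\<^sup>2) \<le> (norm (\<Sum>i\<in>J. g i))\<^sup>2"
      and "(norm (\<Sum>i\<in>J. g i))\<^sup>2 \<le> B * (\<Sum>i\<in>J. (norm (g i))\<^sup>2)"
      by auto
  qed
  then show ?thesis by (rule that)
qed

theorem corollary2p6:
  fixes scal :: "'k::real_normed_field \<Rightarrow> 'a::{real_inner,complete_space} \<Rightarrow> 'a"
    and I :: "'i set"
    and W V :: "'i \<Rightarrow> 'a set"
    and \<omega> :: "'i \<Rightarrow> real"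
  assumes "hilbert_scaling scal"
    and "separable_space (euclidean :: 'a topology)"
    and "countable I"
    and "riesz_fusion_basis scal I W"
    and "\<forall>i\<in>I. \<omega> i = 1"
    and "bessel_fusion_sequence scal I V \<omega>"
  shows "alternate_dual scal I V \<omega> W \<omega> \<longleftrightarrow>
    (\<forall>i\<in>I. inv (fusion_frame_operator I W \<omega>) ` W i \<subseteq> V i)"
proof -
  obtain A B where "riesz_decomposition I W A B"
    using riesz_fusion_basis_decomposition[OF assms(1,4)] .
  then interpret riesz_decomposition I W A B .
  have operator: "fusion_frame_operator I W \<omega> = S"
    unfolding fusion_frame_operator_def S_def
    by (intro ext infsum_cong) (simp add: assms(5))
  have weighted: "(\<lambda>i. (\<omega> i)\<^sup>2 * (norm (P i f))\<^sup>2) summable_on I"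
      "(\<Sum>\<^sub>\<infinity>i\<in>I. (\<omega> i)\<^sup>2 * (norm (P i f))\<^sup>2) = energy f" for f
    using energy_summable[of f] assms(5) by (simp_all cong: summable_on_cong infsum_cong)
  \<comment> \<open>For the zero space \<open>A\<close> may exceed \<open>B\<close>, whereas frame bounds must be ordered.\<close>
  have "energy f \<le> max A B * (norm f)\<^sup>2" for f
    using energy_le[of f] by (rule order_trans) (simp add: mult_right_mono)
  then have "\<exists>A B. 0 < A \<and> A \<le> B \<and> (\<forall>f. (\<lambda>i. (\<omega> i)\<^sup>2 * (norm (P i f))\<^sup>2) summable_on I
      \<and> A * (norm f)\<^sup>2 \<le> energy f \<and> energy f \<le> B * (norm f)\<^sup>2)"
    using A_pos energy_ge weighted(1) by (intro exI[of _ A] exI[of _ "max A B"]) simp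
  then have frame: "fusion_frame scal I W \<omega>"
    using assms(4,5) by (simp add: fusion_frame_def riesz_fusion_basis_def weighted(2))
  have V: "subspace (V i) \<and> closed (V i)" if "i \<in> I" for i
    using assms(6) that closed_subspace_real[OF assms(1)]
    by (auto simp: bessel_fusion_sequence_def closed_subspace_def)
  have "((\<lambda>i. (\<omega> i * \<omega> i) *\<^sub>R orth_proj (V i) (inv S (P i f))) has_sum f) I
      \<longleftrightarrow> ((\<lambda>i. orth_proj (V i) (inv S (P i f))) has_sum f) I" for f
    by (rule has_sum_cong) (simp add: assms(5))
  then have "alternate_dual scal I V \<omega> W \<omega>
      \<longleftrightarrow> (\<forall>f. ((\<lambda>i. orth_proj (V i) (inv S (P i f))) has_sum f) I)"
    unfolding alternate_dual_def operator using frame assms(6) by simp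
  then show ?thesis
    unfolding operator using reconstruction_iff[OF V] by simp
qed

end
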